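(* Let $\alpha>0$, $\lambda>0$, let $K\le N\le M$, let $\mathbf{A}:\mathbb{R}^N\to\mathbb{R}^M$ and $\mathbf{B}:\mathbb{R}^N\to\mathbb{R}^K$ be linear operators of maximum rank (so $\operatorname{rank}\mathbf{A}=N$ and $\operatorname{rank}\mathbf{B}=K$), and let $\mathbf{d}\in\mathbb{R}^M$. Assume that $\mathbf{u}=\mathbf{u}^\ast$, $\mathbf{z}=\mathbf{z}^\ast=\mathbf{B}\mathbf{u}^\ast$ is the unique solution of the problem $$\|\mathbf{z}\|_1+\frac{\alpha}{2}\|\mathbf{A}\mathbf{u}-\mathbf{d}\|_2^2\to\min\quad\text{over } (\mathbf{u},\mathbf{z})\in\mathbb{R}^N\times\mathbb{R}^K\ \text{ subject to }\ \mathbf{z}=\mathbf{B}\mathbf{u},$$ and let $\mathbf{b}^\ast=\boldsymbol\mu^\ast/\lambda$, where $\boldsymbol\mu^\ast\in\mathbb{R}^K$ is the vector of Lagrange multipliers for the equality constraint $\mathbf{z}=\mathbf{B}\mathbf{u}$. Let $\mathbf{u}_k,\mathbf{z}_k,\mathbf{b}_k$ ($k=0,1,2,\ldots$) be the iterates produced by the Compressive Conjugate Directions algorithm. Then the algorithm converges to this solution, that is, as $k\to\infty$, $$\mathbf{u}_k\to\mathbf{u}^\ast,\qquad \mathbf{z}_k\to\mathbf{z}^\ast,\qquad \mathbf{b}_k\to\mathbf{b}^\ast.$$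
   Context: Norms: $\|\cdot\|_1$ and $\|\cdot\|_2$ are the $\ell_1$ and Euclidean norms. Lagrange multipliers: the Lagrangian of the problem is $L_0(\mathbf{u},\mathbf{z},\boldsymbol\mu)=\|\mathbf{z}\|_1+\frac{\alpha}{2}\|\mathbf{A}\mathbf{u}-\mathbf{d}\|_2^2+\boldsymbol\mu^T(\mathbf{z}-\mathbf{B}\mathbf{u})$, and $\boldsymbol\mu^\ast$ is a multiplier vector if $(\mathbf{u}^\ast,\mathbf{z}^\ast,\boldsymbol\mu^\ast)$ is a saddle point of $L_0$ (minimum in $(\mathbf{u},\mathbf{z})$, maximum in $\boldsymbol\mu$). Shrinkage: for $\mathbf{y}\in\mathbb{R}^K$ and $\gamma>0$, $\mathrm{shrink}\{\mathbf{y},\gamma\}=\mathrm{argmin}_{\mathbf{x}}\{\gamma\|\mathbf{x}\|_1+\frac12\|\mathbf{y}-\mathbf{x}\|_2^2\}$, i.e. componentwise $\frac{y_i}{|y_i|}\max(|y_i|-\gamma,0)$ (equal to $0$ if $y_i=0$). Operator $\mathbf{F}$: $\mathbf{F}=\begin{bmatrix}\sqrt{\alpha}\,\mathbf{A}\\ \sqrt{\lambda}\,\mathbf{B}\end{bmatrix}:\mathbb{R}^N\to\mathbb{R}^{M+K}$. Compressive Conjugate Directions algorithm (exact arithmetic, run for infinitely many iterations): Initialization: $\mathbf{u}_0=\mathbf{0}$, $\mathbf{z}_0=\mathbf{0}$, $\mathbf{b}_0=\mathbf{0}$, $\mathbf{v}_0=\begin{bmatrix}\sqrt{\alpha}\,\mathbf{d}\\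 \sqrt{\lambda}(\mathbf{z}_0+\mathbf{b}_0)\end{bmatrix}$, $\mathbf{p}_0=\mathbf{F}^T\mathbf{v}_0$, $\mathbf{q}_0=\mathbf{F}\mathbf{p}_0$, $\delta_0=\mathbf{q}_0^T\mathbf{q}_0$ (if $\delta_0=0$, reset $\delta_0=1$, $\mathbf{p}_0=\mathbf{0}$, $\mathbf{q}_0=\mathbf{0}$). For $k=0,1,2,\ldots$: 1. $\tau_i=\mathbf{q}_i^T\mathbf{v}_k/\delta_i$ for $i=0,\ldots,k$ (recomputed at every $k$); 2. $\mathbf{u}_{k+1}=\sum_{i=0}^k\tau_i\mathbf{p}_i$; 3. $\mathbf{z}_{k+1}=\mathrm{shrink}\{\mathbf{B}\mathbf{u}_{k+1}-\mathbf{b}_k,1/\lambda\}$; 4. $\mathbf{b}_{k+1}=\mathbf{b}_k+\mathbf{z}_{k+1}-\mathbf{B}\mathbf{u}_{k+1}$; 5. $\mathbf{v}_{k+1}=\begin{bmatrix}\sqrt{\alpha}\,\mathbf{d}\\ \sqrt{\lambda}(\mathbf{z}_{k+1}+\mathbf{b}_{k+1})\end{bmatrix}$; 6. $\mathbf{r}_{k+1}=\mathbf{v}_{k+1}-\sum_{i=0}^k\tau_i\mathbf{q}_i$, $\mathbf{w}_{k+1}=\mathbf{F}^T\mathbf{r}_{k+1}$, $\mathbf{s}_{k+1}=\mathbf{F}\mathbf{w}_{k+1}$; 7. $\beta_i=-\mathbf{q}_i^T\mathbf{s}_{k+1}/\delta_i$ for $i=0,\ldots,k$; 8. $\mathbf{p}_{k+1}=\sum_{i=0}^k\beta_i\mathbf{p}_i+\mathbf{w}_{k+1}$,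 $\mathbf{q}_{k+1}=\sum_{i=0}^k\beta_i\mathbf{q}_i+\mathbf{s}_{k+1}$, $\delta_{k+1}=\mathbf{q}_{k+1}^T\mathbf{q}_{k+1}$; 9. if $\delta_{k+1}=0$, reset $\delta_{k+1}=1$, $\mathbf{p}_{k+1}=\mathbf{0}$, $\mathbf{q}_{k+1}=\mathbf{0}$. *)

theory Defs
  imports "HOL-Analysis.Analysis"
begin

definition l1norm :: "real ^ 'n \<Rightarrow> real"
  where "l1norm x = (\<Sum>i\<in>UNIV. \<bar>x $ i\<bar>)"

definition shrink :: "real ^ 'n \<Rightarrow> real \<Rightarrow> real ^ 'n"
  where "shrink y \<gamma> = (ARG_MIN (\<lambda>x. \<gamma> * l1norm x + 1 / 2 * (norm (y - x))\<^sup>2) x. True)"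

lemma shrink_scalar_ineq:
  fixes x y \<gamma> :: real
  assumes "\<gamma> > 0"
  defines "s \<equiv> y / \<bar>y\<bar> * max (\<bar>y\<bar> - \<gamma>) 0"
  shows "\<gamma> * \<bar>s\<bar> + 1 / 2 * (y - s)\<^sup>2 + 1 / 2 * (x - s)\<^sup>2 \<le> \<gamma> * \<bar>x\<bar> + 1 / 2 * (y - x)\<^sup>2"
proof -
  have ax: "\<gamma> * x \<le> \<gamma> * \<bar>x\<bar>" "- (\<gamma> * x) \<le> \<gamma> * \<bar>x\<bar>"
    using assms(1) by (auto simp: abs_if mult_nonneg_nonpos mult_pos_neg)
  consider "y > \<gamma>" | "y < - \<gamma>" | "\<bar>y\<bar> \<le> \<gamma>" by linarith
  then show ?thesis
  proof cases
    case 1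
    then have s: "y = s + \<gamma>" "s > 0" using assms(1) by (auto simp: s_def)
    then show ?thesis using ax unfolding s(1) by (simp add: power2_eq_square algebra_simps)
  next
    case 2
    then have s: "y = s - \<gamma>" "s < 0" using assms(1) by (auto simp: s_def)
    then show ?thesis using ax unfolding s(1) by (simp add: power2_eq_square algebra_simps)
  next
    case 3
    then have s: "s = 0" by (auto simp: s_def)
    have "x * y \<le> \<bar>x\<bar> * \<bar>y\<bar>" by (metis abs_ge_self abs_mult)
    also have "\<dots> \<le> \<bar>x\<bar> * \<gamma>" by (rule mult_left_mono[OF 3]) simp
    finally show ?thesis using s by (simp add: power2_eq_square algebra_simps)
  qed
qed

lemma shrink_componentwise:
  fixes y :: "real ^ 'n"
  assumes "\<gamma> > 0"
  shows "shrink y \<gamma> = (\<chi> i. y $ i / \<bar>y $ i\<bar> * max (\<bar>y $ i\<bar> - \<gamma>) 0)"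
proof -
  define f where "f x = \<gamma> * l1norm x + 1 / 2 * (norm (y - x))\<^sup>2" for x :: "real ^ 'n"
  define s where "s = (\<chi> i. y $ i / \<bar>y $ i\<bar> * max (\<bar>y $ i\<bar> - \<gamma>) 0)"
  have nrm: "(norm v)\<^sup>2 = (\<Sum>i\<in>UNIV. (v $ i)\<^sup>2)" for v :: "real ^ 'n"
    by (simp add: norm_vec_def L2_set_def sum_nonneg)
  have key: "f s + 1 / 2 * (norm (x - s))\<^sup>2 \<le> f x" for x
  proof -
    have "f s + 1 / 2 * (norm (x - s))\<^sup>2 =
        (\<Sum>i\<in>UNIV. \<gamma> * \<bar>s $ i\<bar> + 1 / 2 * (y $ i - s $ i)\<^sup>2 + 1 / 2 * (x $ i - s $ i)\<^sup>2)"
      by (simp add: f_def l1norm_def nrm sum.distrib sum_distrib_left sum_divide_distrib)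
    also have "\<dots> \<le> (\<Sum>i\<in>UNIV. \<gamma> * \<bar>x $ i\<bar> + 1 / 2 * (y $ i - x $ i)\<^sup>2)"
      by (rule sum_mono) (use shrink_scalar_ineq[OF assms] in \<open>simp add: s_def\<close>)
    also have "\<dots> = f x"
      by (simp add: f_def l1norm_def nrm sum.distrib sum_distrib_left sum_divide_distrib)
    finally show ?thesis .
  qed
  have "f s \<le> f x" for x
    using key[of x] zero_le_power2[of "norm (x - s)"] by linarith
  then have "f (arg_min f (\<lambda>_. True)) = f s"
    by (intro arg_min_equality) auto
  then have "(norm (arg_min f (\<lambda>_. True) - s))\<^sup>2 \<le> 0"
    using key[of "arg_min f (\<lambda>_. True)"] by linarith
  then have "arg_min f (\<lambda>_. True) = s" by simp
  then show ?thesis by (simp add: shrink_def f_def[abs_def] s_def)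
qed

definition objective ::
    "real \<Rightarrow> real ^ 'n ^ 'm \<Rightarrow> real ^ 'm \<Rightarrow> real ^ 'n \<Rightarrow> real ^ 'k \<Rightarrow> real"
  where "objective \<alpha> A d u z = l1norm z + \<alpha> / 2 * (norm (A *v u - d))\<^sup>2"

definition is_solution ::
    "real \<Rightarrow> real ^ 'n ^ 'm \<Rightarrow> real ^ 'n ^ 'k \<Rightarrow> real ^ 'm \<Rightarrow> real ^ 'n \<Rightarrow> real ^ 'k \<Rightarrow> bool"
  where "is_solution \<alpha> A B d u z \<longleftrightarrow>
    is_arg_min (\<lambda>(u, z). objective \<alpha> A d u z) (\<lambda>(u, z). z = B *v u) (u, z)"

definition lagrangian ::
    "real \<Rightarrow> real ^ 'n ^ 'm \<Rightarrow> real ^ 'n ^ 'k \<Rightarrow> real ^ 'm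
      \<Rightarrow> real ^ 'n \<Rightarrow> real ^ 'k \<Rightarrow> real ^ 'k \<Rightarrow> real"
  where "lagrangian \<alpha> A B d u z \<mu> = objective \<alpha> A d u z + \<mu> \<bullet> (z - B *v u)"

definition is_multiplier ::
    "real \<Rightarrow> real ^ 'n ^ 'm \<Rightarrow> real ^ 'n ^ 'k \<Rightarrow> real ^ 'm
      \<Rightarrow> real ^ 'n \<Rightarrow> real ^ 'k \<Rightarrow> real ^ 'k \<Rightarrow> bool"
  where "is_multiplier \<alpha> A B d us zs \<mu>s \<longleftrightarrow>
    (\<forall>u z. lagrangian \<alpha> A B d us zs \<mu>s \<le> lagrangian \<alpha> A B d u z \<mu>s) \<and>
    (\<forall>\<mu>. lagrangian \<alpha> A B d us zs \<mu> \<le> lagrangian \<alpha> A B d us zs \<mu>s)"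

text \<open>Block columns live in \<^typ>\<open>real ^ ('m + 'k)\<close>: \<^term>\<open>Inl i\<close> indexes the upper block and
  \<^term>\<open>Inr j\<close> the lower one.\<close>

definition F_op ::
    "real \<Rightarrow> real \<Rightarrow> real ^ 'n ^ 'm \<Rightarrow> real ^ 'n ^ 'k \<Rightarrow> real ^ 'n ^ ('m + 'k)"
  where "F_op \<alpha> lam A B =
    (\<chi> r. case r of Inl i \<Rightarrow> sqrt \<alpha> *\<^sub>R A $ i | Inr j \<Rightarrow> sqrt lam *\<^sub>R B $ j)"

definition v_vec ::
    "real \<Rightarrow> real \<Rightarrow> real ^ 'm \<Rightarrow> real ^ 'k \<Rightarrow> real ^ 'k \<Rightarrow> real ^ ('m + 'k)"
  where "v_vec \<alpha> lam d z b =
    (\<chi> r. case r of Inl i \<Rightarrow> sqrt \<alpha> * d $ i | Inr j \<Rightarrow> sqrt lam * (z $ j + b $ j))"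

text \<open>State after \<open>k\<close> iterations. The fields \<open>it_p\<close>, \<open>it_q\<close>, \<open>it_\<delta>\<close> hold the whole history of
  directions; only their values at indices \<open>0, \<dots>, k\<close> are meaningful.\<close>

record ('n::finite, 'm::finite, 'k::finite) ccd_state =
  it_u :: "real ^ 'n"
  it_z :: "real ^ 'k"
  it_b :: "real ^ 'k"
  it_v :: "real ^ ('m + 'k)"
  it_p :: "nat \<Rightarrow> real ^ 'n"
  it_q :: "nat \<Rightarrow> real ^ ('m + 'k)"
  it_\<delta> :: "nat \<Rightarrow> real"

definition ccd_init ::
    "real \<Rightarrow> real \<Rightarrow> real ^ 'n ^ 'm \<Rightarrow> real ^ 'n ^ 'k \<Rightarrow> real ^ 'm \<Rightarrow> ('n, 'm, 'k) ccd_state"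
  where "ccd_init \<alpha> lam A B d =
    (let F = F_op \<alpha> lam A B;
         u = 0; z = 0; b = 0;
         v = v_vec \<alpha> lam d z b;
         p = transpose F *v v;
         q = F *v p;
         \<delta> = q \<bullet> q
     in \<lparr>it_u = u, it_z = z, it_b = b, it_v = v,
         it_p = (\<lambda>_. if \<delta> = 0 then 0 else p),
         it_q = (\<lambda>_. if \<delta> = 0 then 0 else q),
         it_\<delta> = (\<lambda>_. if \<delta> = 0 then 1 else \<delta>)\<rparr>)"

definition ccd_step ::
    "real \<Rightarrow> real \<Rightarrow> real ^ 'n ^ 'm \<Rightarrow> real ^ 'n ^ 'k \<Rightarrow> real ^ 'm \<Rightarrow> nat
      \<Rightarrow> ('n, 'm, 'k) ccd_state \<Rightarrow> ('n, 'm, 'k) ccd_state"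
  where "ccd_step \<alpha> lam A B d k S =
    (let F = F_op \<alpha> lam A B;
         p = it_p S; q = it_q S; \<delta> = it_\<delta> S;
         \<tau> = (\<lambda>i. (q i \<bullet> it_v S) / \<delta> i);
         u = (\<Sum>i\<le>k. \<tau> i *\<^sub>R p i);
         z = shrink (B *v u - it_b S) (1 / lam);
         b = it_b S + z - B *v u;
         v = v_vec \<alpha> lam d z b;
         r = v - (\<Sum>i\<le>k. \<tau> i *\<^sub>R q i);
         w = transpose F *v r;
         s = F *v w;
         \<beta> = (\<lambda>i. - (q i \<bullet> s) / \<delta> i);
         p' = (\<Sum>i\<le>k. \<beta> i *\<^sub>R p i) + w;
         q' = (\<Sum>i\<le>k. \<beta> i *\<^sub>R q i) + s;
         \<delta>' = q' \<bullet> q'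
     in \<lparr>it_u = u, it_z = z, it_b = b, it_v = v,
         it_p = p(Suc k := if \<delta>' = 0 then 0 else p'),
         it_q = q(Suc k := if \<delta>' = 0 then 0 else q'),
         it_\<delta> = \<delta>(Suc k := if \<delta>' = 0 then 1 else \<delta>')\<rparr>)"

primrec ccd ::
    "real \<Rightarrow> real \<Rightarrow> real ^ 'n ^ 'm \<Rightarrow> real ^ 'n ^ 'k \<Rightarrow> real ^ 'm \<Rightarrow> nat
      \<Rightarrow> ('n, 'm, 'k) ccd_state"
  where
    "ccd \<alpha> lam A B d 0 = ccd_init \<alpha> lam A B d"
  | "ccd \<alpha> lam A B d (Suc k) = ccd_step \<alpha> lam A B d k (ccd \<alpha> lam A B d k)"

end

theory Submission
  imports Defs
begin

text \<open>
  Let \<open>V\<^sub>k\<close> be the span of the search directions \<open>p\<^sub>0, \<dots>, p\<^sub>k\<close>, and \<open>F\<close> the block operator. The vectors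
  \<open>q\<^sub>i = F p\<^sub>i\<close> are mutually orthogonal, so \<open>u\<^sub>k\<^sub>+\<^sub>1\<close> is the exact least-squares solution of \<open>F u = v\<^sub>k\<close>
  over \<open>V\<^sub>k\<close>. The increasing spaces \<open>V\<^sub>k\<close> stabilise at some subspace \<open>V\<close>, and from then on the
  iteration is the alternating direction method of multipliers for the problem restricted to \<open>V\<close>.
  The space \<open>V\<close> need not be the whole of \<open>\<real>\<^sup>N\<close>: a direction vanishes whenever the new residual
  gradient \<open>w\<^sub>k\<^sub>+\<^sub>1 = F\<^sup>T r\<^sub>k\<^sub>+\<^sub>1\<close> already lies in the current space. The proof therefore has two parts.

  The restricted method converges. The restricted problem has a Karush-Kuhn-Tucker pair
  (\<open>kkt_on_subspace_exists\<close>), obtained by solving its dual, which is a projection onto a closed convex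
  set. With \<open>(u, z, b)\<close> denoting the deviation from such a pair, \<open>\<parallel>z\<^sub>k - b\<^sub>k\<parallel>\<^sup>2\<close> is a Lyapunov function
  (\<open>admm_on_subspace_primal_limit\<close>), and its decrease forces \<open>u\<^sub>k\<close> and \<open>z\<^sub>k\<close> to converge.

  The restricted limit solves the full problem. Once the spaces have stabilised, the residual gradient
  \<open>w\<^sub>k\<^sub>+\<^sub>1\<close> belongs to \<open>V\<close>, for otherwise it would enlarge the space. By the least-squares property it is
  also orthogonal to \<open>V\<close> up to the effect of the change of \<open>z + b\<close> in one step, which tends to zero.
  Hence \<open>w\<^sub>k\<close> tends to zero, and this limit relation is stationarity in all of \<open>\<real>\<^sup>N\<close>. It determines the
  limit of \<open>B\<^sup>T b\<^sub>k\<close>, hence that of \<open>b\<^sub>k\<close>, because \<open>B\<^sup>T\<close> is injective (\<open>admm_on_subspace_limit\<close>). The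
  limit is a Karush-Kuhn-Tucker pair of the full problem, and such a pair is unique (\<open>kkt_unique\<close>).
\<close>

section \<open>Adjoints, injectivity and the block operator\<close>

text \<open>A left inverse matrix recovers the sequence continuously from its image.\<close>

lemma tendsto_if_injective_image_tendsto:
  fixes A :: "real ^ 'n ^ 'm"
  assumes "inj ((*v) A)" and lim: "(\<lambda>k. A *v x k) \<longlonglongrightarrow> l"
  obtains x0 where "x \<longlonglongrightarrow> x0" "A *v x0 = l"
proof -
  obtain C where C: "C ** A = mat 1"
    using assms(1) matrix_left_invertible_injective by blast
  have bl: "bounded_linear ((*v) C)" "bounded_linear ((*v) A)" by auto
  have "(\<lambda>k. C *v (A *v x k)) \<longlonglongrightarrow> C *v l"
    by (rule bounded_linear.tendsto[OF bl(1) lim])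
  then have x0: "x \<longlonglongrightarrow> C *v l"
    by (simp add: matrix_vector_mul_assoc C)
  have "A *v (C *v l) = l"
    using bounded_linear.tendsto[OF bl(2) x0] lim LIMSEQ_unique by blast
  with x0 show ?thesis using that by blast
qed

lemma inner_sum_index:
  fixes x y :: "real ^ ('m::finite + 'k::finite)"
  shows "x \<bullet> y = (\<Sum>i\<in>UNIV. x $ Inl i * y $ Inl i) + (\<Sum>j\<in>UNIV. x $ Inr j * y $ Inr j)"
proof -
  have "x \<bullet> y = (\<Sum>i\<in>UNIV <+> UNIV. x $ i * y $ i)"
    by (simp add: inner_vec_def)
  then show ?thesis by (simp add: sum.Plus del: UNIV_Plus_UNIV)
qed

lemma F_op_mult_nth:
  "(F_op \<alpha> lam A B *v x) $ Inl i = sqrt \<alpha> * (A *v x) $ i"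
  "(F_op \<alpha> lam A B *v x) $ Inr j = sqrt lam * (B *v x) $ j"
  by (simp_all add: F_op_def matrix_vector_mult_def sum_distrib_left mult.assoc)

lemma inner_F_op:
  assumes "\<alpha> \<ge> 0" "lam \<ge> 0"
  shows "(F_op \<alpha> lam A B *v x) \<bullet> (F_op \<alpha> lam A B *v y)
    = \<alpha> * ((A *v x) \<bullet> (A *v y)) + lam * ((B *v x) \<bullet> (B *v y))"
proof -
  have sq: "sqrt c * s * (sqrt c * t) = c * (s * t)" if "c \<ge> 0" for c s t
    using that by (metis mult.assoc mult.left_commute real_sqrt_mult_self abs_of_nonneg)
  show ?thesis
    using assms
    by (simp add: inner_sum_index F_op_mult_nth sq sum_distrib_left inner_vec_def)
qed

lemma inner_v_vec_F_op:
  assumes "\<alpha> \<ge> 0" "lam \<ge> 0"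
  shows "v_vec \<alpha> lam d z b \<bullet> (F_op \<alpha> lam A B *v y)
    = \<alpha> * (d \<bullet> (A *v y)) + lam * ((z + b) \<bullet> (B *v y))"
proof -
  have sq: "sqrt c * s * (sqrt c * t) = c * (s * t)" if "c \<ge> 0" for c s t
    using that by (metis mult.assoc mult.left_commute real_sqrt_mult_self abs_of_nonneg)
  show ?thesis
    using assms
    by (simp add: inner_sum_index F_op_mult_nth sq sum_distrib_left inner_vec_def v_vec_def)
qed

lemma F_op_mult_eq_0_imp:
  fixes A :: "real ^ 'n ^ 'm" and B :: "real ^ 'n ^ 'k"
  assumes "\<alpha> > 0" "lam > 0" "inj ((*v) A)" and "F_op \<alpha> lam A B *v x = 0"
  shows "x = 0"
proof -
  from assms(4) have "\<alpha> * ((A *v x) \<bullet> (A *v x)) + lam * ((B *v x) \<bullet> (B *v x)) = 0"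
    using inner_F_op[of \<alpha> lam A B x x] assms by simp
  then have "(A *v x) \<bullet> (A *v x) = 0"
    using assms by (smt (verit) inner_ge_zero mult_nonneg_nonneg mult_pos_pos)
  then have "A *v x = A *v 0" by simp
  with assms(3) show "x = 0" by (meson injD)
qed

section \<open>Subgradients of the $\ell_1$ norm\<close>

definition l1_subgradient :: "real ^ 'n \<Rightarrow> real ^ 'n \<Rightarrow> bool"
  where "l1_subgradient g z \<longleftrightarrow> (\<forall>i. \<bar>g $ i\<bar> \<le> 1) \<and> g \<bullet> z = l1norm z"

lemma inner_le_l1norm:
  assumes "\<forall>i. \<bar>g $ i\<bar> \<le> 1"
  shows "g \<bullet> z \<le> l1norm z"
  unfolding inner_vec_def l1norm_def
proof (rule sum_mono)
  fix i
  have "g $ i * z $ i \<le> \<bar>g $ i\<bar> * \<bar>z $ i\<bar>" by (metis abs_ge_self abs_mult)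
  also have "\<dots> \<le> 1 * \<bar>z $ i\<bar>" using assms by (intro mult_right_mono) auto
  finally show "g $ i \<bullet> z $ i \<le> \<bar>z $ i\<bar>" by simp
qed

text \<open>A subgradient pairs at least as well with its own point as any other vector of the unit box does.\<close>

lemma l1_subgradient_monotone:
  assumes "l1_subgradient g z" "l1_subgradient g' z'"
  shows "(g - g') \<bullet> (z - z') \<ge> 0"
  using assms inner_le_l1norm[of g z'] inner_le_l1norm[of g' z]
  by (simp add: l1_subgradient_def inner_diff)

lemma l1_subgradient_limit:
  assumes "g \<longlonglongrightarrow> g0" "z \<longlonglongrightarrow> z0" "\<And>k. l1_subgradient (g k) (z k)"
  shows "l1_subgradient g0 z0"
  unfolding l1_subgradient_def
proof (intro conjI allI)
  fix i
  have "(\<lambda>k. \<bar>g k $ i\<bar>) \<longlonglongrightarrow> \<bar>g0 $ i\<bar>"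
    using assms(1) by (intro tendsto_intros)
  then show "\<bar>g0 $ i\<bar> \<le> 1"
    by (rule LIMSEQ_le_const2) (use assms(3) in \<open>auto simp: l1_subgradient_def\<close>)
next
  have "(\<lambda>k. g k \<bullet> z k) \<longlonglongrightarrow> g0 \<bullet> z0"
    using assms(1,2) by (rule tendsto_inner)
  moreover have "(\<lambda>k. l1norm (z k)) \<longlonglongrightarrow> l1norm z0"
    unfolding l1norm_def using assms(2) by (intro tendsto_intros)
  moreover have "(\<lambda>k. g k \<bullet> z k) = (\<lambda>k. l1norm (z k))"
    using assms(3) by (auto simp: l1_subgradient_def)
  ultimately show "g0 \<bullet> z0 = l1norm z0"
    using LIMSEQ_unique by metis
qed

text \<open>The first-order condition for the minimum that defines shrinkage. It makes \<open>-\<lambda> b\<^sub>k\<close> a subgradient at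
  \<open>z\<^sub>k\<close> throughout the algorithm.\<close>

lemma shrink_residual_subgradient:
  fixes y :: "real ^ 'n"
  assumes "lam > 0"
  shows "l1_subgradient (lam *\<^sub>R (y - shrink y (1 / lam))) (shrink y (1 / lam))"
proof -
  have g: "1 / lam > 0" using assms by simp
  have *: "\<bar>lam * (t - s)\<bar> \<le> 1 \<and> lam * (t - s) * s = \<bar>s\<bar>"
    if "s = t / \<bar>t\<bar> * max (\<bar>t\<bar> - 1 / lam) 0" for s t :: real
  proof -
    consider "t > 1 / lam" | "t < - (1 / lam)" | "\<bar>t\<bar> \<le> 1 / lam" by linarith
    then show ?thesis
    proof cases
      case 1
      then have "t > 0" using g by linarith
      with 1 have s: "s = t - 1 / lam" "s > 0" using that by auto
      then have "lam * (t - s) = 1" using assms by simp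
      with s show ?thesis by simp
    next
      case 2
      then have "t < 0" using g by linarith
      with 2 have s: "s = t + 1 / lam" "s < 0" using that by auto
      then have "lam * (t - s) = -1" using assms by simp
      with s show ?thesis by simp
    next
      case 3
      then have "s = 0" using that by simp
      moreover have "\<bar>lam * t\<bar> \<le> 1" using 3 assms by (simp add: abs_mult field_simps)
      ultimately show ?thesis by simp
    qed
  qed
  show ?thesis
    unfolding l1_subgradient_def inner_vec_def l1norm_def shrink_componentwise[OF g]
  proof (intro conjI allI sum.cong refl, goal_cases)
    case (1 i)
    show ?case using *[OF refl, of "y $ i"] by simp
  next
    case (2 i)
    show ?case using *[OF refl, of "y $ i"] by simp
  qed
qed

section \<open>Optimality conditions relative to a subspace\<close>

text \<open>Optimality of \<open>(u, B u)\<close> with multiplier \<open>\<mu>\<close> when \<open>u\<close> ranges over \<open>V\<close> only: the first condition is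
  stationarity of the Lagrangian in \<open>u\<close>, the second is stationarity in \<open>z\<close>. The full problem is the
  case \<open>V = UNIV\<close>.\<close>

definition kkt_on ::
    "(real ^ 'n) set \<Rightarrow> real \<Rightarrow> real ^ 'n ^ 'm \<Rightarrow> real ^ 'n ^ 'k \<Rightarrow> real ^ 'm
      \<Rightarrow> real ^ 'n \<Rightarrow> real ^ 'k \<Rightarrow> bool"
  where "kkt_on V \<alpha> A B d u \<mu> \<longleftrightarrow> u \<in> V \<and>
    (\<forall>h\<in>V. \<alpha> * ((A *v u - d) \<bullet> (A *v h)) = \<mu> \<bullet> (B *v h)) \<and>
    l1_subgradient (- \<mu>) (B *v u)"

lemma nonneg_quadratic_imp_linear_coeff_zero:
  fixes c a :: real
  assumes "\<And>t. 0 \<le> t * c + t\<^sup>2 * a"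
  shows "c = 0"
proof (rule ccontr)
  assume "c \<noteq> 0"
  define e where "e = \<bar>a\<bar> + 1"
  then have e: "e > 0" "a \<le> e" by auto
  define t where "t = - c / (2 * e)"
  have "t * c + t\<^sup>2 * a \<le> t * c + t\<^sup>2 * e"
    using e by (intro add_left_mono mult_left_mono) auto
  also have "\<dots> = - (c\<^sup>2 / (4 * e))"
    using e(1) unfolding t_def by (simp add: field_simps power2_eq_square)
  also have "\<dots> < 0" using \<open>c \<noteq> 0\<close> e(1) by simp
  finally show False using assms[of t] by linarith
qed

text \<open>Minimality of the saddle point in \<open>z\<close>, tested at \<open>0\<close>, at \<open>2 z\<^sup>*\<close> and at signed unit vectors, gives
  the subgradient condition, since \<open>\<parallel>z\<parallel>\<^sub>1 + \<mu> \<bullet> z\<close> is positively homogeneous. Minimality in \<open>u\<close> along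
  lines gives stationarity.\<close>

lemma multiplier_imp_kkt:
  fixes A :: "real ^ 'n ^ 'm" and B :: "real ^ 'n ^ 'k"
  assumes mult: "is_multiplier \<alpha> A B d us (B *v us) \<mu>"
  shows "kkt_on UNIV \<alpha> A B d us \<mu>"
proof -
  have min: "lagrangian \<alpha> A B d us (B *v us) \<mu> \<le> lagrangian \<alpha> A B d u z \<mu>" for u z
    using mult by (auto simp: is_multiplier_def)
  have z: "l1norm (B *v us) + \<mu> \<bullet> (B *v us) \<le> l1norm z + \<mu> \<bullet> z" for z
    using min[of us z] by (simp add: lagrangian_def objective_def inner_diff_right)
  have l1_2: "l1norm (2 *\<^sub>R (B *v us)) = 2 * l1norm (B *v us)"
    by (simp add: l1norm_def abs_mult sum_distrib_left)
  have l1_0: "l1norm (0 :: real ^ 'k) = 0" by (simp add: l1norm_def)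
  have eq: "l1norm (B *v us) + \<mu> \<bullet> (B *v us) = 0"
    using z[of 0] z[of "2 *\<^sub>R (B *v us)"] l1_2 l1_0 by simp
  have "\<bar>\<mu> $ i\<bar> \<le> 1" for i
  proof -
    have "l1norm (axis i c :: real ^ 'k) = \<bar>c\<bar>" for c
    proof -
      have "(\<Sum>j\<in>UNIV. \<bar>(axis i c :: real ^ 'k) $ j\<bar>) = (\<Sum>j\<in>UNIV. if j = i then \<bar>c\<bar> else 0)"
        by (rule sum.cong) (auto simp: axis_def)
      then show ?thesis by (simp add: l1norm_def)
    qed
    then show ?thesis
      using z[of "axis i 1"] z[of "axis i (-1)"] eq by (simp add: inner_axis)
  qed
  moreover have "\<alpha> * ((A *v us - d) \<bullet> (A *v h)) = \<mu> \<bullet> (B *v h)" for h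
  proof -
    have "0 \<le> t * (\<alpha> * ((A *v us - d) \<bullet> (A *v h)) - \<mu> \<bullet> (B *v h))
        + t\<^sup>2 * (\<alpha> / 2 * ((A *v h) \<bullet> (A *v h)))" for t
    proof -
      have "A *v (us + t *\<^sub>R h) - d = (A *v us - d) + t *\<^sub>R (A *v h)"
        by (simp add: matrix_vector_right_distrib matrix_vector_mult_scaleR)
      then have "(norm (A *v (us + t *\<^sub>R h) - d))\<^sup>2 = (norm (A *v us - d))\<^sup>2
          + 2 * t * ((A *v us - d) \<bullet> (A *v h)) + t\<^sup>2 * ((A *v h) \<bullet> (A *v h))"
        unfolding power2_norm_eq_inner
        by (simp add: inner_add inner_commute power2_eq_square algebra_simps)
      moreover have "B *v us - B *v (us + t *\<^sub>R h) = - (t *\<^sub>R (B *v h))"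
        by (simp add: matrix_vector_right_distrib matrix_vector_mult_scaleR)
      moreover have "\<alpha> / 2 * (norm (A *v us - d))\<^sup>2
          \<le> \<alpha> / 2 * (norm (A *v (us + t *\<^sub>R h) - d))\<^sup>2 + \<mu> \<bullet> (B *v us - B *v (us + t *\<^sub>R h))"
        using min[of "us + t *\<^sub>R h" "B *v us"]
        unfolding lagrangian_def objective_def by simp
      ultimately have "\<alpha> / 2 * (norm (A *v us - d))\<^sup>2 \<le> \<alpha> / 2 * ((norm (A *v us - d))\<^sup>2
          + 2 * t * ((A *v us - d) \<bullet> (A *v h)) + t\<^sup>2 * ((A *v h) \<bullet> (A *v h))) - t * (\<mu> \<bullet> (B *v h))"
        by simp
      then show ?thesis by (simp add: field_simps)
    qed
    from nonneg_quadratic_imp_linear_coeff_zero[OF this] show ?thesis by simp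
  qed
  ultimately show ?thesis
    using eq by (simp add: kkt_on_def l1_subgradient_def)
qed

text \<open>Subtracting the two stationarity conditions and using monotonicity of the subgradient bounds
  \<open>\<alpha> \<parallel>A (u - u')\<parallel>\<^sup>2\<close> by zero; then \<open>B\<^sup>T \<mu> = B\<^sup>T \<mu>'\<close>.\<close>

lemma kkt_unique:
  fixes A :: "real ^ 'n ^ 'm" and B :: "real ^ 'n ^ 'k"
  assumes "\<alpha> > 0" "inj ((*v) A)" "inj ((*v) (transpose B))"
    and 1: "kkt_on UNIV \<alpha> A B d u \<mu>" and 2: "kkt_on UNIV \<alpha> A B d u' \<mu>'"
  shows "u = u'" "\<mu> = \<mu>'"
proof -
  have st: "\<alpha> * ((A *v u - d) \<bullet> (A *v h)) = \<mu> \<bullet> (B *v h)"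
    "\<alpha> * ((A *v u' - d) \<bullet> (A *v h)) = \<mu>' \<bullet> (B *v h)" for h
    using 1 2 by (auto simp: kkt_on_def)
  have "\<alpha> * ((A *v (u - u')) \<bullet> (A *v (u - u'))) = (\<mu> - \<mu>') \<bullet> (B *v (u - u'))"
    using st[of "u - u'"] by (simp add: matrix_vector_mult_diff_distrib inner_diff algebra_simps)
  also have "\<dots> \<le> 0"
    using 1 2 l1_subgradient_monotone[of "- \<mu>" "B *v u" "- \<mu>'" "B *v u'"]
    by (simp add: kkt_on_def matrix_vector_mult_diff_distrib inner_diff algebra_simps)
  finally have "(A *v (u - u')) \<bullet> (A *v (u - u')) = 0"
    using \<open>\<alpha> > 0\<close> by (smt (verit) inner_ge_zero mult_pos_pos)
  then have "A *v u = A *v u'" by (simp add: matrix_vector_mult_diff_distrib)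
  then show u: "u = u'" using assms(2) by (meson injD)
  have "(transpose B *v \<mu>) \<bullet> h = (transpose B *v \<mu>') \<bullet> h" for h
    using st[of h] u by (simp add: dot_lmul_matrix)
  then have "transpose B *v \<mu> = transpose B *v \<mu>'"
    using vector_eq_rdot by blast
  then show "\<mu> = \<mu>'" using assms(3) by (meson injD)
qed

text \<open>The dual of the restricted problem asks for the point of least norm among the vectors \<open>x\<close> that satisfy
  the stationarity condition in place of \<open>A u\<close>, for some \<open>\<mu>\<close> in the unit box. This set is closed because
  the box is compact, so a minimiser exists. Optimality against perturbations orthogonal to \<open>A V\<close> shows
  \<open>x = A u\<close> with \<open>u \<in> V\<close>; optimality against changes of \<open>\<mu>\<close> shows that \<open>\<mu>\<close> minimises \<open>\<nu> \<bullet> B u\<close> over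
  the \<open>\<nu>\<close> in the box, which is the subgradient condition.\<close>

lemma kkt_on_subspace_exists:
  fixes A :: "real ^ 'n ^ 'm" and B :: "real ^ 'n ^ 'k"
  assumes "\<alpha> > 0" and inj: "inj ((*v) A)" and V: "subspace V"
  obtains u \<mu> where "kkt_on V \<alpha> A B d u \<mu>"
proof -
  define box where "box = (cbox (- 1) 1 :: (real ^ 'k) set)"
  have box: "\<mu> \<in> box \<longleftrightarrow> (\<forall>i. \<bar>\<mu> $ i\<bar> \<le> 1)" for \<mu>
    by (auto simp: box_def mem_box_cart abs_le_iff minus_le_iff)
  define S where "S = {x. \<exists>\<mu>\<in>box. \<forall>h\<in>V. \<alpha> * ((x - d) \<bullet> (A *v h)) = \<mu> \<bullet> (B *v h)}"
  have "d \<in> S" by (auto simp: S_def box intro!: bexI[of _ 0])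
  then have ne: "S \<noteq> {}" by blast
  have cl: "closed S"
    unfolding closed_sequential_limits
  proof (intro allI impI)
    fix x l assume "(\<forall>n. x n \<in> S) \<and> x \<longlonglongrightarrow> l"
    then have x: "\<And>n. x n \<in> S" "x \<longlonglongrightarrow> l" by auto
    from x(1) obtain m where m: "\<And>n. m n \<in> box"
      "\<And>n h. h \<in> V \<Longrightarrow> \<alpha> * ((x n - d) \<bullet> (A *v h)) = m n \<bullet> (B *v h)"
      unfolding S_def by simp metis
    have "compact box" by (simp add: box_def)
    then obtain \<mu> r where r: "\<mu> \<in> box" "strict_mono r" "(m \<circ> r) \<longlonglongrightarrow> \<mu>"
      using m(1) unfolding compact_def by metis
    have xr: "(x \<circ> r) \<longlonglongrightarrow> l" using x(2) r(2) LIMSEQ_subseq_LIMSEQ by blast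
    have "\<alpha> * ((l - d) \<bullet> (A *v h)) = \<mu> \<bullet> (B *v h)" if "h \<in> V" for h
    proof -
      have "(\<lambda>n. \<alpha> * (((x \<circ> r) n - d) \<bullet> (A *v h))) \<longlonglongrightarrow> \<alpha> * ((l - d) \<bullet> (A *v h))"
        by (intro tendsto_intros xr)
      moreover have "(\<lambda>n. (m \<circ> r) n \<bullet> (B *v h)) \<longlonglongrightarrow> \<mu> \<bullet> (B *v h)"
        by (intro tendsto_intros r(3))
      ultimately show ?thesis using m(2)[OF that] LIMSEQ_unique by (simp add: o_def)
    qed
    then show "l \<in> S" using r(1) by (auto simp: S_def)
  qed
  have cvx: "convex S"
    unfolding convex_def
  proof (intro ballI allI impI)
    fix x y and s t :: real
    assume "x \<in> S" "y \<in> S" and st: "0 \<le> s" "0 \<le> t" "s + t = 1"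
    then obtain \<mu> \<nu> where m: "\<mu> \<in> box" "\<nu> \<in> box"
      "\<And>h. h \<in> V \<Longrightarrow> \<alpha> * ((x - d) \<bullet> (A *v h)) = \<mu> \<bullet> (B *v h)"
      "\<And>h. h \<in> V \<Longrightarrow> \<alpha> * ((y - d) \<bullet> (A *v h)) = \<nu> \<bullet> (B *v h)"
      unfolding S_def by auto
    have "s *\<^sub>R \<mu> + t *\<^sub>R \<nu> \<in> box"
      using convex_box(1)[of "- 1" 1] m(1,2) st unfolding box_def convex_def by blast
    moreover have "s *\<^sub>R x + t *\<^sub>R y - d = s *\<^sub>R (x - d) + t *\<^sub>R (y - d)"
      using st(3) by (simp add: algebra_simps scaleR_add_left[symmetric])
    then have "\<alpha> * ((s *\<^sub>R x + t *\<^sub>R y - d) \<bullet> (A *v h)) = (s *\<^sub>R \<mu> + t *\<^sub>R \<nu>) \<bullet> (B *v h)"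
      if "h \<in> V" for h
      by (simp only: inner_add_left inner_scaleR_left m(3,4)[OF that, symmetric] distrib_left
          mult.left_commute[of \<alpha>])
    ultimately show "s *\<^sub>R x + t *\<^sub>R y \<in> S" unfolding S_def by blast
  qed
  define x where "x = closest_point S 0"
  have xS: "x \<in> S" using closest_point_in_set[OF cl ne] by (simp add: x_def)
  have vi: "x \<bullet> (y - x) \<ge> 0" if "y \<in> S" for y
    using any_closest_point_dot[OF cvx cl xS that, of 0] closest_point_exists(2)[OF cl ne, of 0]
    by (simp add: x_def)
  from xS obtain \<mu> where \<mu>: "\<mu> \<in> box"
    "\<And>h. h \<in> V \<Longrightarrow> \<alpha> * ((x - d) \<bullet> (A *v h)) = \<mu> \<bullet> (B *v h)"
    unfolding S_def by auto
  have W: "subspace ((*v) A ` V)"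
    using V by (simp add: linear_subspace_image)
  \<comment> \<open>Moving \<open>x\<close> by \<open>n\<close> or \<open>-n\<close> stays in \<open>S\<close> with the same \<open>\<mu>\<close>, so \<open>x\<close> is orthogonal to \<open>n\<close>.\<close>
  have "x \<bullet> n = 0" if n: "n \<in> ((*v) A ` V)\<^sup>\<bottom>" for n
  proof -
    have "n \<bullet> (A *v h) = 0" if "h \<in> V" for h
      using n that by (auto simp: orthogonal_comp_def orthogonal_def inner_commute)
    then have "x + n \<in> S" "x - n \<in> S"
      using \<mu> by (auto simp: S_def inner_add inner_diff intro!: bexI[of _ \<mu>])
    from vi[OF this(1)] vi[OF this(2)] show ?thesis by (simp add: inner_minus_right)
  qed
  then have "x \<in> (((*v) A ` V)\<^sup>\<bottom>)\<^sup>\<bottom>"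
    by (auto simp: orthogonal_comp_def orthogonal_def inner_commute)
  then obtain u where u: "u \<in> V" "x = A *v u"
    using orthogonal_comp_self[OF W] by auto
  have surj: "surj ((*v) (transpose A))"
    using inj by (metis full_rank_injective full_rank_surjective rank_transpose)
  \<comment> \<open>Since \<open>A\<^sup>T\<close> is onto, every \<open>\<nu>\<close> in the box belongs to a point of \<open>S\<close>.\<close>
  have dual: "(\<nu> - \<mu>) \<bullet> (B *v u) \<ge> 0" if "\<nu> \<in> box" for \<nu>
  proof -
    obtain c where c: "transpose A *v c = (1 / \<alpha>) *\<^sub>R (transpose B *v (\<nu> - \<mu>))"
      using surj by (metis surjD)
    have c': "\<alpha> * (c \<bullet> (A *v h)) = (\<nu> - \<mu>) \<bullet> (B *v h)" for h
      using arg_cong[OF c, of "\<lambda>w. w \<bullet> h"] \<open>\<alpha> > 0\<close>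
      by (simp add: dot_lmul_matrix field_simps)
    have "x + c \<in> S"
      unfolding S_def
      using \<mu>(2) c' that
      by (auto intro!: bexI[of _ \<nu>] simp: inner_add_left inner_diff_left algebra_simps)
    from vi[OF this] have "x \<bullet> c \<ge> 0" by simp
    then show ?thesis
      using c'[of u] u(2) \<open>\<alpha> > 0\<close> by (metis inner_commute mult_nonneg_nonneg less_imp_le)
  qed
  define \<nu> where "\<nu> = (\<chi> i. - sgn ((B *v u) $ i))"
  have "\<nu> \<in> box" by (auto simp: box \<nu>_def sgn_if)
  moreover have "\<nu> \<bullet> (B *v u) = - l1norm (B *v u)"
    by (auto simp: \<nu>_def inner_vec_def l1norm_def sum_negf[symmetric] sgn_if intro!: sum.cong)
  ultimately have "(- \<mu>) \<bullet> (B *v u) \<ge> l1norm (B *v u)"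
    using dual[of \<nu>] by (simp add: inner_diff_left)
  moreover have m1: "\<forall>i. \<bar>(- \<mu>) $ i\<bar> \<le> 1" using \<mu>(1) by (simp add: box)
  ultimately have "l1_subgradient (- \<mu>) (B *v u)"
    using inner_le_l1norm[OF m1, of "B *v u"] by (simp add: l1_subgradient_def)
  then have "kkt_on V \<alpha> A B d u \<mu>" using \<mu>(2) u by (simp add: kkt_on_def)
  then show ?thesis by (rule that)
qed

section \<open>Convergence of the alternating iteration on a subspace\<close>

text \<open>The method is Douglas-Rachford splitting in the variable \<open>z - b\<close>, so its distance to a fixed point
  decreases. With deviations \<open>Z\<close>, \<open>\<beta>\<close> of \<open>z\<close>, \<open>b\<close> from the optimum and \<open>Y = B (u\<^sub>k\<^sub>+\<^sub>1 - u\<^sup>*)\<close>, the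
  multiplier update reads \<open>Z' - \<beta>' = Y - \<beta>\<close>. Expanding its square and inserting the optimality of
  \<open>u\<^sub>k\<^sub>+\<^sub>1\<close> tested with \<open>u\<^sub>k\<^sub>+\<^sub>1 - u\<^sup>*\<close> yields the decrease \<open>\<parallel>Y - Z\<parallel>\<^sup>2 + 2 (\<alpha> / \<lambda>) \<parallel>A (u\<^sub>k\<^sub>+\<^sub>1 - u\<^sup>*)\<parallel>\<^sup>2\<close>,
  up to the term \<open>2 \<beta> \<bullet> Z\<close>, which is nonpositive by monotonicity of the subgradient.\<close>

lemma admm_on_subspace_primal_limit:
  fixes A :: "real ^ 'n ^ 'm" and B :: "real ^ 'n ^ 'k"
    and u :: "nat \<Rightarrow> real ^ 'n" and z b :: "nat \<Rightarrow> real ^ 'k"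
  assumes pos: "\<alpha> > 0" "lam > 0" and inj: "inj ((*v) A)"
    and kkt: "kkt_on V \<alpha> A B d ub \<mu>" and V: "subspace V"
    and uV: "\<And>k. u (Suc k) \<in> V"
    and opt: "\<And>k h. h \<in> V \<Longrightarrow>
      \<alpha> * ((A *v u (Suc k) - d) \<bullet> (A *v h)) + lam * ((B *v u (Suc k) - z k - b k) \<bullet> (B *v h)) = 0"
    and b: "\<And>k. b (Suc k) = b k + z (Suc k) - B *v u (Suc k)"
    and sub: "\<And>k. l1_subgradient (- (lam *\<^sub>R b k)) (z k)"
  shows "u \<longlonglongrightarrow> ub" "z \<longlonglongrightarrow> B *v ub"
proof -
  define bb where "bb = (1 / lam) *\<^sub>R \<mu>"
  define Z where "Z k = z k - B *v ub" for k
  define \<beta> where "\<beta> k = b k - bb" for k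
  define Y where "Y k = B *v (u (Suc k) - ub)" for k
  define c where "c k = (A *v (u (Suc k) - ub)) \<bullet> (A *v (u (Suc k) - ub))" for k
  define E where "E k = (Z k - \<beta> k) \<bullet> (Z k - \<beta> k)" for k
  have \<mu>: "\<mu> = lam *\<^sub>R bb" using pos by (simp add: bb_def)
  have mono: "\<beta> k \<bullet> Z k \<le> 0" for k
  proof -
    have "(- (lam *\<^sub>R b k) - (- \<mu>)) \<bullet> Z k \<ge> 0"
      using l1_subgradient_monotone[OF sub] kkt unfolding kkt_on_def Z_def by blast
    moreover have "- (lam *\<^sub>R b k) - (- \<mu>) = (- lam) *\<^sub>R \<beta> k"
      by (simp add: \<mu> \<beta>_def algebra_simps)
    ultimately show ?thesis using pos by (simp add: mult_le_0_iff zero_le_mult_iff)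
  qed
  have step: "\<alpha> * c k + lam * ((Y k - Z k - \<beta> k) \<bullet> Y k) = 0" for k
  proof -
    have h: "u (Suc k) - ub \<in> V"
      using uV kkt V by (auto simp: kkt_on_def intro: subspace_diff)
    have B: "B *v u (Suc k) - z k - b k = (Y k - Z k - \<beta> k) - bb"
      by (simp add: Y_def Z_def \<beta>_def matrix_vector_mult_diff_distrib)
    have A: "A *v u (Suc k) - d = A *v (u (Suc k) - ub) + (A *v ub - d)"
      by (simp add: matrix_vector_mult_diff_distrib)
    have "\<alpha> * ((A *v ub - d) \<bullet> (A *v (u (Suc k) - ub))) = lam * (bb \<bullet> Y k)"
      using kkt h by (simp add: kkt_on_def \<mu> Y_def)
    moreover have "\<alpha> * (c k + (A *v ub - d) \<bullet> (A *v (u (Suc k) - ub)))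
        + lam * ((Y k - Z k - \<beta> k) \<bullet> Y k - bb \<bullet> Y k) = 0"
      using opt[OF h, of k]
      unfolding A B c_def Y_def[symmetric] inner_add_left inner_diff_left[of _ bb] .
    ultimately show ?thesis by (simp only: distrib_left right_diff_distrib)
  qed
  have s: "Z (Suc k) - \<beta> (Suc k) = Y k - \<beta> k" for k
    by (simp add: Z_def \<beta>_def Y_def b matrix_vector_mult_diff_distrib)
  have dec: "E (Suc k) + (Y k - Z k) \<bullet> (Y k - Z k) + 2 * ((\<alpha> / lam) * c k) \<le> E k" for k
  proof -
    have c: "(\<alpha> / lam) * c k + (Y k - Z k - \<beta> k) \<bullet> Y k = 0"
      using step[of k] pos by (simp add: field_simps)
    have "E (Suc k) + (Y k - Z k) \<bullet> (Y k - Z k) + 2 * ((\<alpha> / lam) * c k)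
        = E k + 2 * (\<beta> k \<bullet> Z k)
          + 2 * ((\<alpha> / lam) * c k + (Y k - Z k - \<beta> k) \<bullet> Y k)"
      by (simp add: E_def s inner_diff inner_commute algebra_simps)
    then show ?thesis using c mono[of k] by simp
  qed
  have cpos: "(\<alpha> / lam) * c k \<ge> 0" for k
    using pos by (simp add: c_def)
  have Epos: "E k \<ge> 0" for k by (simp add: E_def)
  have c_le: "(\<alpha> / lam) * c k \<le> E k - E (Suc k)"
    and YZ_le: "(Y k - Z k) \<bullet> (Y k - Z k) \<le> E k - E (Suc k)" for k
    using dec[of k] cpos[of k] inner_ge_zero[of "Y k - Z k"] by linarith+
  have "E (Suc k) \<le> E k" for k
    using c_le[of k] cpos[of k] by linarith
  then have "decseq E" by (rule decseq_SucI)
  then obtain L where L: "E \<longlonglongrightarrow> L"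
    using decseq_convergent[of E 0] Epos by blast
  have gap: "(\<lambda>k. E k - E (Suc k)) \<longlonglongrightarrow> 0"
    using tendsto_diff[OF L LIMSEQ_Suc[OF L]] by simp
  have "(\<lambda>k. (\<alpha> / lam) * c k) \<longlonglongrightarrow> 0"
    using cpos c_le by (intro tendsto_sandwich[OF _ _ tendsto_const gap] always_eventually allI)
  then have "(\<lambda>k. (lam / \<alpha>) * ((\<alpha> / lam) * c k)) \<longlonglongrightarrow> (lam / \<alpha>) * 0"
    by (rule tendsto_mult_left)
  then have "c \<longlonglongrightarrow> 0" using pos by simp
  then have "(\<lambda>k. sqrt (c k)) \<longlonglongrightarrow> sqrt 0" by (rule tendsto_real_sqrt)
  then have "(\<lambda>k. norm (A *v (u (Suc k) - ub))) \<longlonglongrightarrow> 0"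
    by (simp add: c_def norm_eq_sqrt_inner)
  then have "(\<lambda>k. A *v (u (Suc k) - ub)) \<longlonglongrightarrow> 0"
    by (rule tendsto_norm_zero_cancel)
  then obtain e where e: "(\<lambda>k. u (Suc k) - ub) \<longlonglongrightarrow> e" "A *v e = 0"
    by (rule tendsto_if_injective_image_tendsto[OF inj])
  then have "e = 0" using inj by (metis injD matrix_vector_mult_0_right)
  with e(1) have "(\<lambda>k. u (Suc k) - ub + ub) \<longlonglongrightarrow> 0 + ub"
    by (intro tendsto_add) auto
  then have uS: "(\<lambda>k. u (Suc k)) \<longlonglongrightarrow> ub" by simp
  then show "u \<longlonglongrightarrow> ub" by (rule LIMSEQ_imp_Suc)
  have bl: "bounded_linear ((*v) B)" by auto
  have Bu: "(\<lambda>k. B *v u (Suc k)) \<longlonglongrightarrow> B *v ub"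
    by (rule bounded_linear.tendsto[OF bl uS])
  have "(\<lambda>k. (Y k - Z k) \<bullet> (Y k - Z k)) \<longlonglongrightarrow> 0"
    using YZ_le by (intro tendsto_sandwich[OF _ _ tendsto_const gap] always_eventually allI) auto
  then have "(\<lambda>k. sqrt ((Y k - Z k) \<bullet> (Y k - Z k))) \<longlonglongrightarrow> sqrt 0"
    by (rule tendsto_real_sqrt)
  then have "(\<lambda>k. Y k - Z k) \<longlonglongrightarrow> 0"
    using tendsto_norm_zero_cancel by (simp add: norm_eq_sqrt_inner[symmetric])
  from tendsto_diff[OF Bu this] show "z \<longlonglongrightarrow> B *v ub"
    by (simp add: Y_def Z_def matrix_vector_mult_diff_distrib)
qed

text \<open>Membership of the residual gradients \<open>w\<close> in \<open>V\<close> is what turns a limit that is optimal on \<open>V\<close> into one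
  that is optimal everywhere. On \<open>V\<close>, pairing with \<open>w k\<close> is the same as pairing with
  \<open>\<lambda> B\<^sup>T D k\<close>, where \<open>D k\<close> is the change of \<open>z + b\<close> in one step; as \<open>w k\<close> itself lies in \<open>V\<close>, its norm is
  bounded by that of this vanishing vector.\<close>

lemma admm_on_subspace_limit:
  fixes A :: "real ^ 'n ^ 'm" and B :: "real ^ 'n ^ 'k"
    and u w :: "nat \<Rightarrow> real ^ 'n" and z b :: "nat \<Rightarrow> real ^ 'k"
  assumes pos: "\<alpha> > 0" "lam > 0" and inj: "inj ((*v) A)" "inj ((*v) (transpose B))"
    and V: "subspace V"
    and uV: "\<And>k. u (Suc k) \<in> V"
    and opt: "\<And>k h. h \<in> V \<Longrightarrow>
      \<alpha> * ((A *v u (Suc k) - d) \<bullet> (A *v h)) + lam * ((B *v u (Suc k) - z k - b k) \<bullet> (B *v h)) = 0"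
    and b: "\<And>k. b (Suc k) = b k + z (Suc k) - B *v u (Suc k)"
    and sub: "\<And>k. l1_subgradient (- (lam *\<^sub>R b k)) (z k)"
    and wV: "\<And>k. w k \<in> V"
    and w: "\<And>k h. w k \<bullet> h = \<alpha> * ((d - A *v u (Suc k)) \<bullet> (A *v h))
      + lam * ((z (Suc k) + b (Suc k) - B *v u (Suc k)) \<bullet> (B *v h))"
  obtains ub bb where "u \<longlonglongrightarrow> ub" "z \<longlonglongrightarrow> B *v ub" "b \<longlonglongrightarrow> bb"
    "kkt_on UNIV \<alpha> A B d ub (lam *\<^sub>R bb)"
proof -
  obtain ub \<mu> where kkt: "kkt_on V \<alpha> A B d ub \<mu>"
    by (rule kkt_on_subspace_exists[OF pos(1) inj(1) V])
  note lims = admm_on_subspace_primal_limit[where u = u and z = z and b = b,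
      OF pos inj(1) kkt V uV opt b sub]
  have blA: "bounded_linear ((*v) A)" and blB: "bounded_linear ((*v) B)"
    and blAt: "bounded_linear ((*v) (transpose A))"
    and blBt: "bounded_linear ((*v) (transpose B))" by auto
  have uS: "(\<lambda>k. u (Suc k)) \<longlonglongrightarrow> ub" and zS: "(\<lambda>k. z (Suc k)) \<longlonglongrightarrow> B *v ub"
    using lims by (simp_all add: LIMSEQ_Suc)
  have Bu: "(\<lambda>k. B *v u (Suc k)) \<longlonglongrightarrow> B *v ub"
    by (rule bounded_linear.tendsto[OF blB uS])
  \<comment> \<open>This is \<open>z + b\<close> at \<open>Suc k\<close> minus \<open>z + b\<close> at \<open>k\<close>, with the update of \<open>b\<close> inserted.\<close>
  define D where "D k = z (Suc k) - z k + (z (Suc k) - B *v u (Suc k))" for k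
  have "D \<longlonglongrightarrow> B *v ub - B *v ub + (B *v ub - B *v ub)"
    unfolding D_def by (intro tendsto_add tendsto_diff zS lims(2) Bu)
  then have D: "(\<lambda>k. lam *\<^sub>R (transpose B *v D k)) \<longlonglongrightarrow> 0"
    using tendsto_scaleR[OF tendsto_const bounded_linear.tendsto[OF blBt], of D 0 sequentially lam]
    by simp
  have wD: "w k \<bullet> h = (lam *\<^sub>R (transpose B *v D k)) \<bullet> h" if "h \<in> V" for k h
  proof -
    have "(lam *\<^sub>R (transpose B *v D k)) \<bullet> h = lam * (D k \<bullet> (B *v h))"
      by (simp add: dot_lmul_matrix)
    then show ?thesis
      using opt[OF that, of k] unfolding w D_def b inner_add_left inner_diff_left
      by (simp add: algebra_simps)
  qed
  have "norm (w k) \<le> norm (lam *\<^sub>R (transpose B *v D k))" for k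
  proof (cases "w k = 0")
    case False
    have "norm (w k) * norm (w k) = w k \<bullet> w k"
      by (simp add: power2_norm_eq_inner[symmetric] power2_eq_square)
    also have "\<dots> = (lam *\<^sub>R (transpose B *v D k)) \<bullet> w k" by (rule wD[OF wV])
    also have "\<dots> \<le> norm (lam *\<^sub>R (transpose B *v D k)) * norm (w k)"
      by (rule norm_cauchy_schwarz)
    finally show ?thesis using False by simp
  qed simp
  then have w0: "w \<longlonglongrightarrow> 0"
    by (intro Lim_null_comparison[OF _ tendsto_norm_zero[OF D]] always_eventually) simp
  have Bb: "transpose B *v b (Suc k) = (1 / lam) *\<^sub>R (w k - \<alpha> *\<^sub>R (transpose A *v (d - A *v u (Suc k))))
      - transpose B *v (z (Suc k) - B *v u (Suc k))" for k
  proof -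
    have wk: "w k = \<alpha> *\<^sub>R (transpose A *v (d - A *v u (Suc k)))
        + lam *\<^sub>R (transpose B *v (z (Suc k) + b (Suc k) - B *v u (Suc k)))"
      using w[of k] by (intro vector_eq_rdot[THEN iffD1])
        (simp add: inner_add_left dot_lmul_matrix)
    have "(1 / lam) *\<^sub>R (w k - \<alpha> *\<^sub>R (transpose A *v (d - A *v u (Suc k))))
        = transpose B *v (b (Suc k) + (z (Suc k) - B *v u (Suc k)))"
      unfolding wk using pos by (simp add: algebra_simps)
    then show ?thesis
      by (simp only: matrix_vector_right_distrib add_diff_cancel_right')
  qed
  have "(\<lambda>k. transpose B *v b (Suc k)) \<longlonglongrightarrow>
      (1 / lam) *\<^sub>R (0 - \<alpha> *\<^sub>R (transpose A *v (d - A *v ub))) - transpose B *v (B *v ub - B *v ub)"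
    unfolding Bb
    by (intro tendsto_diff tendsto_scaleR tendsto_const w0 zS Bu
        bounded_linear.tendsto[OF blAt] bounded_linear.tendsto[OF blBt]
        bounded_linear.tendsto[OF blA uS])
  then obtain bb where bb: "(\<lambda>k. b (Suc k)) \<longlonglongrightarrow> bb"
    "transpose B *v bb = (1 / lam) *\<^sub>R (0 - \<alpha> *\<^sub>R (transpose A *v (d - A *v ub)))
      - transpose B *v (B *v ub - B *v ub)"
    by (rule tendsto_if_injective_image_tendsto[OF inj(2)])
  have b_lim: "b \<longlonglongrightarrow> bb" using bb(1) by (rule LIMSEQ_imp_Suc)
  have "\<alpha> * ((A *v ub - d) \<bullet> (A *v h)) = (lam *\<^sub>R bb) \<bullet> (B *v h)" for h
    using arg_cong[OF bb(2), of "\<lambda>x. lam * (x \<bullet> h)"] pos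
    by (simp add: dot_lmul_matrix inner_diff_left algebra_simps)
  moreover have "l1_subgradient (- (lam *\<^sub>R bb)) (B *v ub)"
    by (rule l1_subgradient_limit[OF _ lims(2) sub]) (intro tendsto_intros b_lim)
  ultimately have "kkt_on UNIV \<alpha> A B d ub (lam *\<^sub>R bb)" by (simp add: kkt_on_def)
  with lims b_lim show ?thesis by (rule that)
qed

section \<open>Conjugacy of the search directions\<close>

text \<open>Later states only append to the history of directions, so the \<open>i\<close>-th entries are read off the state in
  which they are created.\<close>

definition ccd_p where "ccd_p \<alpha> lam A B d i = it_p (ccd \<alpha> lam A B d i) i"

definition ccd_q where "ccd_q \<alpha> lam A B d i = it_q (ccd \<alpha> lam A B d i) i"

definition ccd_\<delta> where "ccd_\<delta> \<alpha> lam A B d i = it_\<delta> (ccd \<alpha> lam A B d i) i"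

lemma ccd_history:
  assumes "i \<le> k"
  shows "it_p (ccd \<alpha> lam A B d k) i = ccd_p \<alpha> lam A B d i"
    "it_q (ccd \<alpha> lam A B d k) i = ccd_q \<alpha> lam A B d i"
    "it_\<delta> (ccd \<alpha> lam A B d k) i = ccd_\<delta> \<alpha> lam A B d i"
proof -
  have "it_p (ccd \<alpha> lam A B d k) i = ccd_p \<alpha> lam A B d i \<and>
      it_q (ccd \<alpha> lam A B d k) i = ccd_q \<alpha> lam A B d i \<and>
      it_\<delta> (ccd \<alpha> lam A B d k) i = ccd_\<delta> \<alpha> lam A B d i"
    using assms
  proof (induction k rule: dec_induct)
    case base
    show ?case by (simp add: ccd_p_def ccd_q_def ccd_\<delta>_def)
  next
    case (step k)
    then show ?case by (simp add: ccd_step_def Let_def)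
  qed
  then show "it_p (ccd \<alpha> lam A B d k) i = ccd_p \<alpha> lam A B d i"
    "it_q (ccd \<alpha> lam A B d k) i = ccd_q \<alpha> lam A B d i"
    "it_\<delta> (ccd \<alpha> lam A B d k) i = ccd_\<delta> \<alpha> lam A B d i" by auto
qed

text \<open>The index is that of the iteration: \<open>ccd_w \<dots> k\<close> and \<open>ccd_\<beta> \<dots> k\<close> are the \<open>w\<^sub>k\<^sub>+\<^sub>1\<close> and the
  coefficients \<open>\<beta>\<close> from which direction \<open>k + 1\<close> is formed.\<close>

definition ccd_w where
  "ccd_w \<alpha> lam A B d k = transpose (F_op \<alpha> lam A B) *v
    (it_v (ccd \<alpha> lam A B d (Suc k)) - (\<Sum>i\<le>k. ((ccd_q \<alpha> lam A B d i \<bullet> it_v (ccd \<alpha> lam A B d k))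
      / ccd_\<delta> \<alpha> lam A B d i) *\<^sub>R ccd_q \<alpha> lam A B d i))"

definition ccd_\<beta> where
  "ccd_\<beta> \<alpha> lam A B d k i =
    - (ccd_q \<alpha> lam A B d i \<bullet> (F_op \<alpha> lam A B *v ccd_w \<alpha> lam A B d k)) / ccd_\<delta> \<alpha> lam A B d i"

lemma ccd_v: "it_v (ccd \<alpha> lam A B d k) =
    v_vec \<alpha> lam d (it_z (ccd \<alpha> lam A B d k)) (it_b (ccd \<alpha> lam A B d k))"
  by (cases k) (simp_all add: ccd_init_def ccd_step_def Let_def)

lemma ccd_u_Suc: "it_u (ccd \<alpha> lam A B d (Suc k)) =
    (\<Sum>i\<le>k. ((ccd_q \<alpha> lam A B d i \<bullet> it_v (ccd \<alpha> lam A B d k)) / ccd_\<delta> \<alpha> lam A B d i)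
      *\<^sub>R ccd_p \<alpha> lam A B d i)"
  by (simp add: ccd_step_def Let_def ccd_history)

lemma ccd_z_Suc: "it_z (ccd \<alpha> lam A B d (Suc k)) =
    shrink (B *v it_u (ccd \<alpha> lam A B d (Suc k)) - it_b (ccd \<alpha> lam A B d k)) (1 / lam)"
  by (simp add: ccd_step_def Let_def)

lemma ccd_b_Suc: "it_b (ccd \<alpha> lam A B d (Suc k)) =
    it_b (ccd \<alpha> lam A B d k) + it_z (ccd \<alpha> lam A B d (Suc k))
      - B *v it_u (ccd \<alpha> lam A B d (Suc k))"
  by (simp add: ccd_step_def Let_def)

lemma matrix_vector_mult_sum_scaleR:
  fixes A :: "real ^ 'n ^ 'm"
  shows "A *v (\<Sum>i\<in>I. c i *\<^sub>R p i) = (\<Sum>i\<in>I. c i *\<^sub>R (A *v p i))"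
  by (simp add: linear_sum[OF matrix_vector_mul_linear] matrix_vector_mult_scaleR)

lemma ccd_p_Suc: "ccd_p \<alpha> lam A B d (Suc k) =
    (if (\<Sum>i\<le>k. ccd_\<beta> \<alpha> lam A B d k i *\<^sub>R ccd_q \<alpha> lam A B d i)
        + F_op \<alpha> lam A B *v ccd_w \<alpha> lam A B d k = 0 then 0
     else (\<Sum>i\<le>k. ccd_\<beta> \<alpha> lam A B d k i *\<^sub>R ccd_p \<alpha> lam A B d i) + ccd_w \<alpha> lam A B d k)"
  unfolding ccd_\<beta>_def ccd_w_def
  by (subst ccd_p_def) (simp add: ccd_step_def Let_def ccd_history)

text \<open>The reset of a vanishing direction replaces \<open>q\<close> by the value zero that it already has, so the
  recurrence for \<open>q\<close> has no exceptional case.\<close>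

lemma ccd_q_Suc: "ccd_q \<alpha> lam A B d (Suc k) =
    (\<Sum>i\<le>k. ccd_\<beta> \<alpha> lam A B d k i *\<^sub>R ccd_q \<alpha> lam A B d i)
      + F_op \<alpha> lam A B *v ccd_w \<alpha> lam A B d k"
  unfolding ccd_\<beta>_def ccd_w_def
  by (subst ccd_q_def) (simp add: ccd_step_def Let_def ccd_history)

lemma ccd_q_eq: "ccd_q \<alpha> lam A B d i = F_op \<alpha> lam A B *v ccd_p \<alpha> lam A B d i"
proof (induction i rule: less_induct)
  case (less i)
  show ?case
  proof (cases i)
    case 0
    then show ?thesis by (simp add: ccd_p_def ccd_q_def ccd_init_def Let_def)
  next
    case (Suc k)
    have "F_op \<alpha> lam A B *v ((\<Sum>i\<le>k. c i *\<^sub>R ccd_p \<alpha> lam A B d i) + w)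
        = (\<Sum>i\<le>k. c i *\<^sub>R ccd_q \<alpha> lam A B d i) + F_op \<alpha> lam A B *v w" for c w
      using less Suc by (simp add: matrix_vector_right_distrib matrix_vector_mult_sum_scaleR)
    then show ?thesis
      unfolding Suc ccd_p_Suc ccd_q_Suc by simp
  qed
qed

lemma ccd_w_eq: "ccd_w \<alpha> lam A B d k = transpose (F_op \<alpha> lam A B) *v
    (it_v (ccd \<alpha> lam A B d (Suc k)) - F_op \<alpha> lam A B *v it_u (ccd \<alpha> lam A B d (Suc k)))"
  unfolding ccd_w_def ccd_u_Suc matrix_vector_mult_sum_scaleR ccd_q_eq ..

lemma ccd_\<delta>_eq: "ccd_\<delta> \<alpha> lam A B d i =
    (if ccd_q \<alpha> lam A B d i = 0 then 1 else ccd_q \<alpha> lam A B d i \<bullet> ccd_q \<alpha> lam A B d i)"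
  by (cases i) (simp_all add: ccd_q_def ccd_\<delta>_def ccd_init_def ccd_step_def Let_def)

text \<open>The coefficients \<open>\<beta>\<close> are those of Gram-Schmidt. A direction that was reset has \<open>q = 0\<close>, and the value
  \<open>\<delta> = 1\<close> stored for it makes its terms vanish.\<close>

lemma ccd_q_orthogonal:
  "i \<noteq> j \<Longrightarrow> ccd_q \<alpha> lam A B d i \<bullet> ccd_q \<alpha> lam A B d j = 0"
proof -
  define q where "q = ccd_q \<alpha> lam A B d"
  define s where "s k = F_op \<alpha> lam A B *v ccd_w \<alpha> lam A B d k" for k
  have \<delta>: "ccd_\<delta> \<alpha> lam A B d i = (if q i = 0 then 1 else q i \<bullet> q i)" for i
    by (simp add: q_def ccd_\<delta>_eq)
  have q_Suc: "q (Suc k) = (\<Sum>i\<le>k. (- (q i \<bullet> s k) / ccd_\<delta> \<alpha> lam A B d i) *\<^sub>R q i) + s k" for k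
    unfolding q_def s_def ccd_q_Suc ccd_\<beta>_def ..
  have "\<forall>i\<le>k. \<forall>j\<le>k. i \<noteq> j \<longrightarrow> q i \<bullet> q j = 0" for k
  proof (induction k)
    case (Suc k)
    have new: "q j \<bullet> q (Suc k) = 0" if "j \<le> k" for j
    proof -
      have "q j \<bullet> (\<Sum>i\<le>k. (- (q i \<bullet> s k) / ccd_\<delta> \<alpha> lam A B d i) *\<^sub>R q i)
          = (\<Sum>i\<le>k. if i = j then (- (q j \<bullet> s k) / ccd_\<delta> \<alpha> lam A B d j) * (q j \<bullet> q j) else 0)"
        unfolding inner_sum_right
        by (rule sum.cong) (use Suc that in auto)
      also have "\<dots> = - (q j \<bullet> s k)"
        using that by (simp add: \<delta>)
      finally show ?thesis by (simp add: q_Suc inner_add_right)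
    qed
    show ?case
      using Suc new by (auto simp: le_Suc_eq inner_commute)
  qed simp
  then show "i \<noteq> j \<Longrightarrow> ccd_q \<alpha> lam A B d i \<bullet> ccd_q \<alpha> lam A B d j = 0"
    using linear[of i j] unfolding q_def by (metis order_refl)
qed

definition ccd_space where
  "ccd_space \<alpha> lam A B d k = span (ccd_p \<alpha> lam A B d ` {..k})"

lemma ccd_u_in_space: "it_u (ccd \<alpha> lam A B d (Suc k)) \<in> ccd_space \<alpha> lam A B d k"
  unfolding ccd_u_Suc ccd_space_def
  by (intro span_sum span_scale span_base) auto

text \<open>The normal equations of the least-squares problem on the current space: by orthogonality of the \<open>q\<^sub>i\<close>,
  the numbers \<open>\<tau>\<^sub>i\<close> are the coefficients of the projection of \<open>v\<^sub>k\<close>.\<close>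

lemma ccd_u_galerkin:
  assumes "h \<in> ccd_space \<alpha> lam A B d k"
  shows "(F_op \<alpha> lam A B *v it_u (ccd \<alpha> lam A B d (Suc k)) - it_v (ccd \<alpha> lam A B d k))
    \<bullet> (F_op \<alpha> lam A B *v h) = 0"
    (is "?r \<bullet> (?F *v h) = 0")
proof -
  define q where "q = ccd_q \<alpha> lam A B d"
  define v where "v = it_v (ccd \<alpha> lam A B d k)"
  have base: "?r \<bullet> (?F *v ccd_p \<alpha> lam A B d j) = 0" if "j \<le> k" for j
  proof -
    have Fu: "?F *v it_u (ccd \<alpha> lam A B d (Suc k)) =
        (\<Sum>i\<le>k. ((q i \<bullet> v) / ccd_\<delta> \<alpha> lam A B d i) *\<^sub>R q i)"
      unfolding ccd_u_Suc matrix_vector_mult_sum_scaleR by (simp add: ccd_q_eq q_def v_def)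
    have "(?F *v it_u (ccd \<alpha> lam A B d (Suc k))) \<bullet> q j
        = (\<Sum>i\<le>k. if i = j then ((q j \<bullet> v) / ccd_\<delta> \<alpha> lam A B d j) * (q j \<bullet> q j) else 0)"
      unfolding Fu inner_sum_left
      by (rule sum.cong) (auto simp: q_def ccd_q_orthogonal)
    also have "\<dots> = q j \<bullet> v"
      using that by (simp add: ccd_\<delta>_eq q_def)
    finally show ?thesis
      by (simp add: ccd_q_eq[symmetric] q_def v_def inner_diff inner_commute del: ccd.simps)
  qed
  have "linear (\<lambda>h. ?r \<bullet> (?F *v h))"
    by (rule linearI) (simp_all add: matrix_vector_right_distrib matrix_vector_mult_scaleR
        inner_add_right)
  then show ?thesis
    using assms base linear_eq_0_on_span[of "\<lambda>h. ?r \<bullet> (?F *v h)"]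
    unfolding ccd_space_def by (metis (no_types, lifting) atMost_iff imageE)
qed

text \<open>The direction is reset only when \<open>F (\<Sum>\<beta>\<^sub>i p\<^sub>i + w) = 0\<close>. As \<open>F\<close> is injective, the vector in brackets is
  then already zero, so it equals the new direction in every case.\<close>

lemma ccd_w_in_space:
  assumes "\<alpha> > 0" "lam > 0" "inj ((*v) A)"
  shows "ccd_w \<alpha> lam A B d k \<in> ccd_space \<alpha> lam A B d (Suc k)"
proof -
  define y where "y = (\<Sum>i\<le>k. ccd_\<beta> \<alpha> lam A B d k i *\<^sub>R ccd_p \<alpha> lam A B d i)"
  have y: "y \<in> ccd_space \<alpha> lam A B d (Suc k)"
    unfolding y_def ccd_space_def by (intro span_sum span_scale span_base) auto
  have p: "ccd_p \<alpha> lam A B d (Suc k) \<in> ccd_space \<alpha> lam A B d (Suc k)"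
    unfolding ccd_space_def by (intro span_base) auto
  have "F_op \<alpha> lam A B *v ccd_p \<alpha> lam A B d (Suc k) = F_op \<alpha> lam A B *v (y + ccd_w \<alpha> lam A B d k)"
    unfolding ccd_q_eq[symmetric] ccd_q_Suc y_def matrix_vector_right_distrib
      matrix_vector_mult_sum_scaleR ..
  then have "F_op \<alpha> lam A B *v (ccd_p \<alpha> lam A B d (Suc k) - (y + ccd_w \<alpha> lam A B d k)) = 0"
    by (simp only: matrix_vector_mult_diff_distrib diff_self)
  from F_op_mult_eq_0_imp[OF assms this] have "ccd_p \<alpha> lam A B d (Suc k) = y + ccd_w \<alpha> lam A B d k"
    by simp
  then have "ccd_w \<alpha> lam A B d k = ccd_p \<alpha> lam A B d (Suc k) - y" by simp
  then show ?thesis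
    using p y unfolding ccd_space_def by (simp add: span_diff)
qed

section \<open>Convergence of the algorithm\<close>

text \<open>The dimensions are bounded, and a space of maximal dimension cannot grow.\<close>

lemma incseq_subspace_eventually_const:
  fixes V :: "nat \<Rightarrow> 'a::euclidean_space set"
  assumes "\<And>k. subspace (V k)" "mono V"
  obtains k0 where "\<And>k. k0 \<le> k \<Longrightarrow> V k = V k0"
proof -
  obtain k0 where k0: "\<And>k. dim (V k) \<le> dim (V k0)"
    using ex_has_greatest_nat[of "\<lambda>_. True" 0 "\<lambda>k. dim (V k)" "Suc DIM('a)"]
      dim_subset_UNIV[of "V _"] by (auto simp: less_Suc_eq_le)
  have "V k = V k0" if "k0 \<le> k" for k
    using subspace_dim_equal[of "V k0" "V k"] assms k0 monoD[OF assms(2) that] by metis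
  then show ?thesis by (rule that)
qed

theorem theorem3p3:
  fixes \<alpha> lam :: real
    and A :: "real ^ 'n ^ 'm" and B :: "real ^ 'n ^ 'k" and d :: "real ^ 'm"
    and us :: "real ^ 'n" and zs bs \<mu>s :: "real ^ 'k"
  assumes "\<alpha> > 0" and "lam > 0"
    and "CARD('k) \<le> CARD('n)" and "CARD('n) \<le> CARD('m)"
    and "rank A = CARD('n)" and "rank B = CARD('k)"
    and "zs = B *v us"
    and "is_solution \<alpha> A B d us zs"
    and "\<forall>u z. is_solution \<alpha> A B d u z \<longrightarrow> u = us \<and> z = zs"
    and "is_multiplier \<alpha> A B d us zs \<mu>s"
    and "bs = \<mu>s /\<^sub>R lam"
  shows "(\<lambda>k. it_u (ccd \<alpha> lam A B d k)) \<longlonglongrightarrow> us \<and>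
         (\<lambda>k. it_z (ccd \<alpha> lam A B d k)) \<longlonglongrightarrow> zs \<and>
         (\<lambda>k. it_b (ccd \<alpha> lam A B d k)) \<longlonglongrightarrow> bs"
proof -
  note pos = assms(1,2)
  have injA: "inj ((*v) A)" using assms(5) by (simp add: full_rank_injective)
  have injB: "inj ((*v) (transpose B))"
    using assms(6) by (metis full_rank_injective rank_transpose)
  define U where "U k = it_u (ccd \<alpha> lam A B d k)" for k
  define Z where "Z k = it_z (ccd \<alpha> lam A B d k)" for k
  define b where "b k = it_b (ccd \<alpha> lam A B d k)" for k
  have mono: "mono (ccd_space \<alpha> lam A B d)"
    unfolding ccd_space_def by (intro monoI span_mono image_mono) auto
  have subsp: "subspace (ccd_space \<alpha> lam A B d k)" for k
    by (simp add: ccd_space_def)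
  obtain k0 where k0: "\<And>k. k0 \<le> k \<Longrightarrow> ccd_space \<alpha> lam A B d k = ccd_space \<alpha> lam A B d k0"
    using incseq_subspace_eventually_const[OF subsp mono] by blast
  \<comment> \<open>From step \<open>k0\<close> on, the shifted iterates follow the alternating direction method on \<open>V\<close>.\<close>
  define V where "V = ccd_space \<alpha> lam A B d k0"
  have bS: "b (Suc k) = b k + Z (Suc k) - B *v U (Suc k)" for k
    unfolding b_def Z_def U_def by (rule ccd_b_Suc)
  have sub: "l1_subgradient (- (lam *\<^sub>R b k)) (Z k)" for k
  proof (cases k)
    case 0
    then show ?thesis
      by (simp add: b_def Z_def ccd_init_def Let_def l1_subgradient_def l1norm_def)
  next
    case (Suc j)
    have "- b (Suc j) = (B *v U (Suc j) - b j) - Z (Suc j)" by (simp add: bS)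
    then show ?thesis
      using shrink_residual_subgradient[OF pos(2), of "B *v U (Suc j) - b j"]
      unfolding Suc scaleR_minus_right[symmetric]
      by (simp only: Z_def U_def b_def ccd_z_Suc)
  qed
  have opt: "\<alpha> * ((A *v U (Suc (k + k0)) - d) \<bullet> (A *v h))
      + lam * ((B *v U (Suc (k + k0)) - Z (k + k0) - b (k + k0)) \<bullet> (B *v h)) = 0"
    if "h \<in> V" for k h
  proof -
    have "h \<in> ccd_space \<alpha> lam A B d (k + k0)" using that k0[of "k + k0"] by (simp add: V_def)
    from ccd_u_galerkin[OF this] pos show ?thesis
      by (simp add: U_def Z_def b_def ccd_v inner_diff_left inner_F_op inner_v_vec_F_op
          inner_add_left algebra_simps del: ccd.simps)
  qed
  have w: "ccd_w \<alpha> lam A B d (k + k0) \<bullet> h = \<alpha> * ((d - A *v U (Suc (k + k0))) \<bullet> (A *v h))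
      + lam * ((Z (Suc (k + k0)) + b (Suc (k + k0)) - B *v U (Suc (k + k0))) \<bullet> (B *v h))"
    for k h
    using pos
    by (simp add: ccd_w_eq U_def Z_def b_def ccd_v dot_lmul_matrix inner_diff_left inner_F_op
        inner_v_vec_F_op inner_add_left algebra_simps del: ccd.simps)
  have uV: "U (Suc (k + k0)) \<in> V" for k
    using ccd_u_in_space[of \<alpha> lam A B d "k + k0"] k0[of "k + k0"] by (simp add: U_def V_def del: ccd.simps)
  have wV: "ccd_w \<alpha> lam A B d (k + k0) \<in> V" for k
    using ccd_w_in_space[OF pos injA, of B d "k + k0"] k0[of "Suc (k + k0)"] by (simp add: V_def)
  have V: "subspace V" unfolding V_def by (rule subsp)
  obtain ub bb where lim: "(\<lambda>k. U (k + k0)) \<longlonglongrightarrow> ub" "(\<lambda>k. Z (k + k0)) \<longlonglongrightarrow> B *v ub"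
    "(\<lambda>k. b (k + k0)) \<longlonglongrightarrow> bb" and kkt: "kkt_on UNIV \<alpha> A B d ub (lam *\<^sub>R bb)"
    by (rule admm_on_subspace_limit[where u = "\<lambda>k. U (k + k0)" and z = "\<lambda>k. Z (k + k0)"
          and b = "\<lambda>k. b (k + k0)" and w = "\<lambda>k. ccd_w \<alpha> lam A B d (k + k0)",
          OF pos injA injB V])
      (simp_all only: add_Suc uV opt bS sub wV w)
  have "kkt_on UNIV \<alpha> A B d us \<mu>s"
    using assms(7,10) by (intro multiplier_imp_kkt) simp
  from kkt_unique[OF pos(1) injA injB kkt this] have "ub = us" "lam *\<^sub>R bb = \<mu>s" .
  then have "ub = us" "bb = bs" using pos assms(11) by auto
  then show ?thesis
    using lim assms(7) unfolding U_def Z_def b_def by (auto dest: LIMSEQ_offset)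
qed

end
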